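(* Let $b:[0,\infty)\times\mathbb{R}^d\to\mathbb{R}^d$ be measurable and assume there is $(p,q)\in(2,\infty)^2$ with $\frac2q+\frac dp<1$ such that $\int_0^T(\int_{\mathbb{R}^d}|b(r,x)|^pdx)^{q/p}dr<\infty$ for all $T>0$. Let $W$ be a standard $d$-dimensional Brownian motion, and let $\Omega_b$ be the full-probability event, with the associated flow of homeomorphisms $(X^{s,x}_t(\omega))$, described in the context. Then for every $(\tau,x,\omega)\in[0,\infty)\times\mathbb{R}^d\times\Omega_b$, the $W(\omega)$-driven backward-in-time equation $$Z^{\tau,x}_s=x-\int_s^\tau b(r,Z^{\tau,x}_r)\,dr-(W_\tau-W_s)(\omega),\qquad 0\le s\le\tau,$$ has a unique solution, given by $Z^{\tau,x}_s=(X^{s,x}_\tau(\omega))^{-1}$ for all $s\in[0,\tau]$.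
   Context: $(X^{s,x}_\tau(\omega))^{-1}$ denotes the inverse of the map $y\mapsto X^{s,y}_\tau(\omega)$ evaluated at $x$. A solution of the backward equation is a measurable $Z:[0,\tau]\to\mathbb{R}^d$ with $\int_0^\tau|b(r,Z_r)|dr<\infty$ satisfying the equation for all $s\in[0,\tau]$. $\Omega_b$ is an event of full probability (such an event exists) such that for every $\omega\in\Omega_b$: (1) the ODE $dY_t=b(t,Y_t)dt+dW_t(\omega)$ generates a continuous semiflow $(X^{s,x}_t(\omega))_{s,t,x}$ over $[0,\infty)$, i.e. a map continuous in $(s,t,x)$, $0\le s\le t$, $x\in\mathbb{R}^d$, with $\int_s^t|b(r,X^{s,x}_r)|dr<\infty$, $X^{s,x}_t=x+\int_s^tb(r,X^{s,x}_r)dr+W_t(\omega)-W_s(\omega)$ and $X^{s,x}_t=X^{u,X^{s,x}_u}_t$ for $s\le u\le t$, which is locally $\kappa$-Hölder continuous in space for every $\kappa\in(0,1)$ (for every compact $[u,v]\times K\subset[0,\infty)\times\mathbb{R}^d$ there is $C<\infty$ with $|X^{s,x}_t-X^{s,y}_t|\le C|x-y|^\kappa$ for $u\le s\le t\le v$, $x,y\in K$); (2) for any $s\ge0$, $x\in\mathbb{R}^d$, any solution of $dY_t=b(t,Y_t)dt+dW_t(\omega)$ starting at $x$ from time $s$ (a measurable $Y$ on some $[s,T]$ with $\int_s^T|b(r,Y_r)|dr<\infty$ and $Y_t=x+\int_s^tb(r,Y_r)dr+W_t(\omega)-W_s(\omega)$) is identical to $X^{s,x}_\cdot(\omega)$;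 (3) for all $0\le s\le t$ the map $x\mapsto X^{s,x}_t(\omega)$ is a homeomorphism of $\mathbb{R}^d$. *)

theory Defs
  imports "HOL-Probability.Probability"
begin

text \<open>Power with a positive real exponent on extended nonnegative reals. The value at infinity is
  set explicitly because \<^const>\<open>enn2real\<close> sends infinity to zero.\<close>

definition ennreal_powr :: "ennreal \<Rightarrow> real \<Rightarrow> ennreal" where
  "ennreal_powr y a = (if y = top then top else ennreal (enn2real y powr a))"

definition locally_Lq_Lp :: "real \<Rightarrow> real \<Rightarrow> (real \<Rightarrow> real ^ 'd \<Rightarrow> real ^ 'd) \<Rightarrow> bool" where
  "locally_Lq_Lp q p b \<longleftrightarrow>
     (\<forall>T>0. (\<integral>\<^sup>+ r \<in> {0..T}.
        ennreal_powr (\<integral>\<^sup>+ x. ennreal (norm (b r x) powr p) \<partial>lborel) (q / p) \<partial>lborel) < \<infinity>)"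

definition standard_brownian_motion :: "'w measure \<Rightarrow> (real \<Rightarrow> 'w \<Rightarrow> real ^ 'd) \<Rightarrow> bool" where
  "standard_brownian_motion M W \<longleftrightarrow>
     prob_space M \<and>
     (\<forall>t\<ge>0. W t \<in> borel_measurable M) \<and>
     (AE \<omega> in M. W 0 \<omega> = 0) \<and>
     (\<forall>(n::nat) t. 0 \<le> t 0 \<and> (\<forall>i<n. t i \<le> t (Suc i)) \<longrightarrow>
        prob_space.indep_vars M (\<lambda>_. borel) (\<lambda>i \<omega>. W (t (Suc i)) \<omega> - W (t i) \<omega>) {..<n}) \<and>
     (\<forall>s t. 0 \<le> s \<and> s < t \<longrightarrow>
        distributed M lborel (\<lambda>\<omega>. W t \<omega> - W s \<omega>)
          (\<lambda>x. ennreal (\<Prod>i\<in>UNIV. normal_density 0 (sqrt (t - s)) (x $ i)))) \<and>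
     (AE \<omega> in M. continuous_on {0..} (\<lambda>t. W t \<omega>))"

text \<open>Below, \<open>w\<close> is one path of the driving signal. \<^const>\<open>set_integrable\<close> amounts to the finiteness
  of the integral of the norm, since the integrand is Borel when the drift and the solution are.\<close>

definition forward_solution ::
  "(real \<Rightarrow> real ^ 'd \<Rightarrow> real ^ 'd) \<Rightarrow> (real \<Rightarrow> real ^ 'd) \<Rightarrow> real \<Rightarrow> real ^ 'd \<Rightarrow> real
    \<Rightarrow> (real \<Rightarrow> real ^ 'd) \<Rightarrow> bool" where
  "forward_solution b w s x T Y \<longleftrightarrow>
     Y \<in> borel_measurable (restrict_space borel {s..T}) \<and>
     set_integrable lborel {s..T} (\<lambda>r. b r (Y r)) \<and>
     (\<forall>t\<in>{s..T}. Y t = x + (LINT r:{s..t}|lborel. b r (Y r)) + w t - w s)"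

definition backward_solution ::
  "(real \<Rightarrow> real ^ 'd \<Rightarrow> real ^ 'd) \<Rightarrow> (real \<Rightarrow> real ^ 'd) \<Rightarrow> real \<Rightarrow> real ^ 'd
    \<Rightarrow> (real \<Rightarrow> real ^ 'd) \<Rightarrow> bool" where
  "backward_solution b w \<tau> x Z \<longleftrightarrow>
     Z \<in> borel_measurable (restrict_space borel {0..\<tau>}) \<and>
     set_integrable lborel {0..\<tau>} (\<lambda>r. b r (Z r)) \<and>
     (\<forall>s\<in>{0..\<tau>}. Z s = x - (LINT r:{s..\<tau>}|lborel. b r (Z r)) - (w \<tau> - w s))"

text \<open>In the following, \<open>\<phi> s t x\<close> is the position at time \<open>t\<close> of the trajectory started from \<open>x\<close> at
  time \<open>s\<close>; only the values with \<open>0 \<le> s \<le> t\<close> matter.\<close>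

definition continuous_semiflow ::
  "(real \<Rightarrow> real ^ 'd \<Rightarrow> real ^ 'd) \<Rightarrow> (real \<Rightarrow> real ^ 'd)
    \<Rightarrow> (real \<Rightarrow> real \<Rightarrow> real ^ 'd \<Rightarrow> real ^ 'd) \<Rightarrow> bool" where
  "continuous_semiflow b w \<phi> \<longleftrightarrow>
     continuous_on {(s, t, x). 0 \<le> s \<and> s \<le> t} (\<lambda>(s, t, x). \<phi> s t x) \<and>
     (\<forall>s t x. 0 \<le> s \<and> s \<le> t \<longrightarrow> forward_solution b w s x t (\<lambda>r. \<phi> s r x)) \<and>
     (\<forall>s u t x. 0 \<le> s \<and> s \<le> u \<and> u \<le> t \<longrightarrow> \<phi> s t x = \<phi> u t (\<phi> s u x))"

definition locally_hoelder_in_space ::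
  "real \<Rightarrow> (real \<Rightarrow> real \<Rightarrow> real ^ 'd \<Rightarrow> real ^ 'd) \<Rightarrow> bool" where
  "locally_hoelder_in_space \<kappa> \<phi> \<longleftrightarrow>
     (\<forall>u v K. 0 \<le> u \<and> u \<le> v \<and> compact K \<longrightarrow>
        (\<exists>C. \<forall>s t x y. u \<le> s \<and> s \<le> t \<and> t \<le> v \<and> x \<in> K \<and> y \<in> K \<longrightarrow>
           norm (\<phi> s t x - \<phi> s t y) \<le> C * norm (x - y) powr \<kappa>))"

definition regular_path ::
  "(real \<Rightarrow> real ^ 'd \<Rightarrow> real ^ 'd) \<Rightarrow> (real \<Rightarrow> real ^ 'd)
    \<Rightarrow> (real \<Rightarrow> real \<Rightarrow> real ^ 'd \<Rightarrow> real ^ 'd) \<Rightarrow> bool" where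
  "regular_path b w \<phi> \<longleftrightarrow>
     continuous_semiflow b w \<phi> \<and>
     (\<forall>\<kappa>. 0 < \<kappa> \<and> \<kappa> < 1 \<longrightarrow> locally_hoelder_in_space \<kappa> \<phi>) \<and>
     (\<forall>s x T Y. 0 \<le> s \<and> s \<le> T \<and> forward_solution b w s x T Y \<longrightarrow>
        (\<forall>t\<in>{s..T}. Y t = \<phi> s t x)) \<and>
     (\<forall>s t. 0 \<le> s \<and> s \<le> t \<longrightarrow> (\<exists>g. homeomorphism UNIV UNIV (\<phi> s t) g))"

end

theory Submission
  imports Defs
begin

text \<open>The backward equation on \<open>[0, \<tau>]\<close> with terminal value \<open>x\<close> is the forward equation with a free
  initial value, conditioned to end at \<open>x\<close>. By uniqueness, forward solutions are the trajectories
  \<open>s \<mapsto> \<phi> 0 s z\<close>, and \<open>\<phi> s \<tau> (\<phi> 0 s z) = \<phi> 0 \<tau> z = x\<close> identifies the position at time \<open>s\<close> as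
  the preimage of \<open>x\<close> under \<open>\<phi> s \<tau>\<close>.\<close>

lemma set_integral_Icc_split:
  fixes f :: "real \<Rightarrow> 'a :: euclidean_space"
  assumes "set_integrable lborel {a..c} f" "a \<le> b" "b \<le> c"
  shows "(LINT r:{a..c}|lborel. f r) = (LINT r:{a..b}|lborel. f r) + (LINT r:{b..c}|lborel. f r)"
proof -
  have "(LINT r:{a..b} \<union> {b..c}|lborel. f r) =
      (LINT r:{a..b}|lborel. f r) + (LINT r:{b..c}|lborel. f r)"
  proof (rule set_integral_Un_AE)
    show "AE r in lborel. \<not> (r \<in> {a..b} \<and> r \<in> {b..c})"
      using AE_lborel_singleton[of b] by eventually_elim auto
    show "set_integrable lborel {a..b} f" "set_integrable lborel {b..c} f"
      using assms by (auto intro: set_integrable_subset)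
  qed auto
  moreover have "{a..b} \<union> {b..c} = {a..c}"
    using assms by auto
  ultimately show ?thesis
    by simp
qed

text \<open>A \<open>simp\<close> rule because \<open>{a..a}\<close> simplifies to
  \<open>{a}\<close>: it evaluates the integral equations where no time has elapsed.\<close>

lemma set_integral_Icc_singleton [simp]:
  fixes f :: "real \<Rightarrow> 'a :: euclidean_space"
  shows "(LINT r:{a}|lborel. f r) = 0"
  unfolding set_lebesgue_integral_def
proof (rule integral_eq_zero_AE)
  show "AE r in lborel. indicator {a} r *\<^sub>R f r = 0"
    using AE_lborel_singleton[of a] by eventually_elim auto
qed

text \<open>Cutting the integral over \<open>{0..\<tau>}\<close> at \<open>s\<close> trades the
  integral up to \<open>\<tau>\<close> for the one from 0. The value at 0, unknown in the backward
  problem, becomes the initial value \<open>Z 0\<close>, and the terminal value becomes a side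
  condition.\<close>

lemma backward_solution_iff_forward_solution:
  assumes "0 \<le> \<tau>"
  shows "backward_solution b w \<tau> x Z \<longleftrightarrow> Z \<tau> = x \<and> forward_solution b w 0 (Z 0) \<tau> Z"
\<comment> \<open>Cutting the integral requires integrability; without it, neither side
  holds.\<close>
proof (cases "set_integrable lborel {0..\<tau>} (\<lambda>r. b r (Z r))")
  case True
  let ?I = "\<lambda>s t. LINT r:{s..t}|lborel. b r (Z r)"
  have split: "?I 0 \<tau> = ?I 0 s + ?I s \<tau>" if "s \<in> {0..\<tau>}" for s
    using set_integral_Icc_split[OF True] that by simp
  have "(\<forall>s\<in>{0..\<tau>}. Z s = x - ?I s \<tau> - (w \<tau> - w s)) \<longleftrightarrow>
      Z \<tau> = x \<and> (\<forall>s\<in>{0..\<tau>}. Z s = Z 0 + ?I 0 s + w s - w 0)" (is "?B \<longleftrightarrow> ?F")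
  proof
    assume ?B
    \<comment> \<open>The backward equation at the two ends; at \<open>\<tau>\<close> the integral
      vanishes.\<close>
    then have ends: "Z \<tau> = x" "Z 0 = x - ?I 0 \<tau> - (w \<tau> - w 0)"
      using assms by auto
    have "Z s = Z 0 + ?I 0 s + w s - w 0" if "s \<in> {0..\<tau>}" for s
    proof -
      have "Z s = x - ?I s \<tau> - (w \<tau> - w s)"
        using \<open>?B\<close> that by blast
      then show ?thesis
        unfolding ends(2) split[OF that] by (simp add: algebra_simps)
    qed
    with ends(1) show ?F
      by blast
  next
    assume F: ?F
    have x: "x = Z 0 + ?I 0 \<tau> + w \<tau> - w 0"
      using conjunct1[OF F] bspec[OF conjunct2[OF F], of \<tau>] assms
      by (metis atLeastAtMost_iff order_refl)
    have "Z s = x - ?I s \<tau> - (w \<tau> - w s)" if "s \<in> {0..\<tau>}" for s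
    proof -
      have "Z s = Z 0 + ?I 0 s + w s - w 0"
        using F that by blast
      then show ?thesis
        unfolding x split[OF that] by (simp add: algebra_simps)
    qed
    then show ?B
      by blast
  qed
  with True show ?thesis
    unfolding backward_solution_def forward_solution_def by blast
next
  case False
  then show ?thesis
    unfolding backward_solution_def forward_solution_def by blast
qed

text \<open>Needed because the inverse maps agree with a trajectory of the flow only for times in
  \<open>{0..\<tau>}\<close>.\<close>

lemma backward_solution_cong:
  assumes "\<And>s. s \<in> {0..\<tau>} \<Longrightarrow> Y s = Z s"
  shows "backward_solution b w \<tau> x Y \<longleftrightarrow> backward_solution b w \<tau> x Z"
proof -
  have "Y \<in> borel_measurable (restrict_space borel {0..\<tau>}) \<longleftrightarrow>
      Z \<in> borel_measurable (restrict_space borel {0..\<tau>})"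
    using assms by (intro measurable_cong) (simp add: space_restrict_space)
  moreover have "set_integrable lborel {0..\<tau>} (\<lambda>r. b r (Y r)) \<longleftrightarrow>
      set_integrable lborel {0..\<tau>} (\<lambda>r. b r (Z r))"
    using assms by (intro set_integrable_cong) auto
  moreover have "(LINT r:{s..\<tau>}|lborel. b r (Y r)) = (LINT r:{s..\<tau>}|lborel. b r (Z r))"
    if "s \<in> {0..\<tau>}" for s
    using assms that by (intro set_lebesgue_integral_cong) auto
  ultimately show ?thesis
    using assms by (simp add: backward_solution_def)
qed

text \<open>Read from left to right this is uniqueness, from right to left existence.\<close>

lemma backward_solution_iff_inv:
  assumes "regular_path b w \<phi>" "0 \<le> \<tau>"
  shows "backward_solution b w \<tau> x Z \<longleftrightarrow> (\<forall>s\<in>{0..\<tau>}. Z s = inv (\<phi> s \<tau>) x)"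
proof -
  have semiflow: "continuous_semiflow b w \<phi>"
    and unique_all: "\<forall>s x T Y. 0 \<le> s \<and> s \<le> T \<and> forward_solution b w s x T Y \<longrightarrow>
      (\<forall>t\<in>{s..T}. Y t = \<phi> s t x)"
    and homeo: "\<forall>s t. 0 \<le> s \<and> s \<le> t \<longrightarrow> (\<exists>g. homeomorphism UNIV UNIV (\<phi> s t) g)"
    using assms(1) unfolding regular_path_def by blast+
  have forward_all: "\<forall>s t x. 0 \<le> s \<and> s \<le> t \<longrightarrow> forward_solution b w s x t (\<lambda>r. \<phi> s r x)"
    and flow_all: "\<forall>s u t x. 0 \<le> s \<and> s \<le> u \<and> u \<le> t \<longrightarrow> \<phi> s t x = \<phi> u t (\<phi> s u x)"
    using semiflow unfolding continuous_semiflow_def by blast+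
  \<comment> \<open>\<open>inv\<close> is defined by choice; bijectivity makes it the genuine
    inverse.\<close>
  have bij: "bij (\<phi> s t)" if st: "0 \<le> s" "s \<le> t" for s t
  proof -
    obtain g where "homeomorphism UNIV UNIV (\<phi> s t) g"
      using homeo st by blast
    then show ?thesis
      unfolding homeomorphism_def by (intro bij_betw_byWitness[of _ g]) simp_all
  qed
  have flow: "\<phi> s \<tau> (\<phi> 0 s z) = \<phi> 0 \<tau> z" if "s \<in> {0..\<tau>}" for s z
    using flow_all[rule_format, of 0 s \<tau> z] that by simp
  have forward: "forward_solution b w 0 z \<tau> (\<lambda>r. \<phi> 0 r z)" for z
    using forward_all assms(2) by simp
  have unique: "Y t = \<phi> 0 t z" if "forward_solution b w 0 z \<tau> Y" "t \<in> {0..\<tau>}" for Y z t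
    using unique_all[rule_format, of 0 \<tau> z Y t] that assms(2) by simp
  \<comment> \<open>The starting point at time 0 of the trajectory that reaches \<open>x\<close> at
    time \<open>\<tau>\<close>.\<close>
  define z where "z = inv (\<phi> 0 \<tau>) x"
  have z: "\<phi> 0 \<tau> z = x"
    using bij[of 0 \<tau>] assms(2) by (simp add: z_def bij_is_surj surj_f_inv_f)
  have inv_eq: "inv (\<phi> s \<tau>) x = \<phi> 0 s z" if "s \<in> {0..\<tau>}" for s
    using bij[of s \<tau>] flow[OF that, of z] that z by (intro inv_f_eq) (auto simp: bij_is_inj)
  show ?thesis
  proof
    assume "backward_solution b w \<tau> x Z"
    then have Z: "Z \<tau> = x" "forward_solution b w 0 (Z 0) \<tau> Z"
      using assms(2) by (simp_all add: backward_solution_iff_forward_solution)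
    \<comment> \<open>By forward uniqueness \<open>Z\<close> follows the flow from
      \<open>Z 0\<close>, so both points are carried to \<open>x\<close>; injectivity then
      identifies them.\<close>
    then have "\<phi> 0 \<tau> (Z 0) = \<phi> 0 \<tau> z"
      using unique[OF Z(2), of \<tau>] assms(2) z by simp
    then have "Z 0 = z"
      using bij[of 0 \<tau>] assms(2) by (simp add: bij_is_inj inj_eq)
    then show "\<forall>s\<in>{0..\<tau>}. Z s = inv (\<phi> s \<tau>) x"
      using unique[OF Z(2)] inv_eq by simp
  next
    assume "\<forall>s\<in>{0..\<tau>}. Z s = inv (\<phi> s \<tau>) x"
    then have "backward_solution b w \<tau> x Z \<longleftrightarrow> backward_solution b w \<tau> x (\<lambda>s. \<phi> 0 s z)"
      using inv_eq by (intro backward_solution_cong) auto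
    \<comment> \<open>The forward characterization starts the trajectory at its own value
      \<open>\<phi> 0 0 z\<close>, while \<open>forward\<close> starts it at \<open>z\<close>. The
      integral equation at time 0 reconciles the two.\<close>
    moreover have "\<phi> 0 0 z = z"
    proof -
      have "\<phi> 0 0 z = z + (LINT r:{0..0}|lborel. b r (\<phi> 0 r z)) + w 0 - w 0"
        using forward[of z] assms(2) unfolding forward_solution_def by (metis atLeastAtMost_iff order_refl)
      then show ?thesis
        by simp
    qed
    ultimately show "backward_solution b w \<tau> x Z"
      using forward[of z] assms(2) z by (simp add: backward_solution_iff_forward_solution)
  qed
qed

theorem theorem6p1:
  fixes b :: "real \<Rightarrow> real ^ 'd \<Rightarrow> real ^ 'd"
    and M :: "'w measure"
    and W :: "real \<Rightarrow> 'w \<Rightarrow> real ^ 'd"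
    and \<Omega>b :: "'w set"
    and X :: "'w \<Rightarrow> real \<Rightarrow> real \<Rightarrow> real ^ 'd \<Rightarrow> real ^ 'd"
  assumes b_measurable:
      "(\<lambda>(t, x). b t x) \<in> borel_measurable (restrict_space borel ({0..} \<times> UNIV))"
    and b_integrable:
      "\<exists>p q. 2 < p \<and> 2 < q \<and> 2 / q + real CARD('d) / p < 1 \<and> locally_Lq_Lp q p b"
    and W: "standard_brownian_motion M W"
    and \<Omega>b_full: "\<Omega>b \<in> sets M" "measure M \<Omega>b = 1"
    and \<Omega>b_flow: "\<And>\<omega>. \<omega> \<in> \<Omega>b \<Longrightarrow> regular_path b (\<lambda>t. W t \<omega>) (X \<omega>)"
  shows "\<forall>\<tau>\<ge>0. \<forall>x. \<forall>\<omega>\<in>\<Omega>b.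
           backward_solution b (\<lambda>t. W t \<omega>) \<tau> x (\<lambda>s. inv (X \<omega> s \<tau>) x) \<and>
           (\<forall>Z. backward_solution b (\<lambda>t. W t \<omega>) \<tau> x Z \<longrightarrow>
              (\<forall>s\<in>{0..\<tau>}. Z s = inv (X \<omega> s \<tau>) x))"
  \<comment> \<open>Existence is the equivalence with \<open>Z\<close> taken to be the inverse
    itself, whose right-hand side is then trivial.\<close>
  using backward_solution_iff_inv[OF \<Omega>b_flow] by blast

end
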